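(* For each positive integer $n$, the following identity holds in the field $\mathbb{Q}(z)$ of rational functions in an indeterminate $z$: $$\sum_{T\in\mathcal{B}(n)} \prod_{v\in T} \frac{(z+h_v)^{h_v-1}}{h_v\,(2z+h_v-1)^{h_v-2}} = \frac{2^n z}{n!}(n+z)^{n-1}.$$
   Context: $\mathcal{B}(n)$ denotes the set of all binary trees with $n$ vertices (each vertex has an optional left child and an optional right child, left and right being distinguished). For a vertex $v$ of a binary tree $T$, the hook length $h_v$ is the number of descendants of $v$ in $T$, counting $v$ itself. The product is over all vertices $v$ of $T$. Negative exponents are allowed (e.g. when $h_v=1$ the factor is $(z+1)^0/(1\cdot(2z)^{-1})=2z$). *)

theory Defs
  imports "HOL-Library.Tree" "HOL-Library.Sublist"
    "HOL-Computational_Algebra.Polynomial_Factorial"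
begin

text \<open>
  A binary tree with unlabelled vertices is a \<^typ>\<open>unit tree\<close>: \<^const>\<open>Leaf\<close> is the empty tree
  (an absent child), and the vertices are the occurrences of \<^const>\<open>Node\<close>.
\<close>

definition binary_trees :: "nat \<Rightarrow> unit tree set" where
  "binary_trees n = {T. size T = n}"

text \<open>
  A vertex is represented by the path leading to it from the root, where \<^const>\<open>False\<close> stands
  for a step to the left child and \<^const>\<open>True\<close> for a step to the right child. Thus the
  descendants of \<open>v\<close>, including \<open>v\<close> itself, are the vertices of which \<open>v\<close> is a prefix.
\<close>

fun vertices :: "'a tree \<Rightarrow> bool list set" where
  "vertices \<langle>\<rangle> = {}"
| "vertices \<langle>l, _, r\<rangle> = {[]} \<union> (#) False ` vertices l \<union> (#) True ` vertices r"

definition hook_length :: "'a tree \<Rightarrow> bool list \<Rightarrow> nat" where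
  "hook_length T v = card {w \<in> vertices T. prefix v w}"

definition indet :: "rat poly fract" where
  "indet = to_fract [:0, 1:]"

lemma finite_vertices [simp]: "finite (vertices T)"
  by (induction T) auto

lemma card_vertices: "card (vertices T) = size T"
proof (induction T)
  case (Node l x r)
  have "card (vertices \<langle>l, x, r\<rangle>)
      = Suc (card ((#) False ` vertices l \<union> (#) True ` vertices r))"
    by (subst vertices.simps, simp) (subst card_insert_disjoint, auto)
  also have "card ((#) False ` vertices l \<union> (#) True ` vertices r)
      = card ((#) False ` vertices l) + card ((#) True ` vertices r)"
    by (rule card_Un_disjoint) auto
  finally show ?case
    using Node by (simp add: card_image)
qed simp

lemma finite_binary_trees [simp]: "finite (binary_trees n)"
proof (induction n rule: less_induct)
  case (less n)
  have "binary_trees n \<subseteq> {\<langle>\<rangle>} \<union>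
      (\<lambda>(l, r). \<langle>l, (), r\<rangle>) ` ((\<Union>k<n. binary_trees k) \<times> (\<Union>k<n. binary_trees k))"
  proof
    fix T assume "T \<in> binary_trees n"
    then show "T \<in> {\<langle>\<rangle>} \<union>
        (\<lambda>(l, r). \<langle>l, (), r\<rangle>) ` ((\<Union>k<n. binary_trees k) \<times> (\<Union>k<n. binary_trees k))"
      by (cases T) (auto simp: binary_trees_def)
  qed
  moreover have "finite (\<Union>k<n. binary_trees k)"
    using less by auto
  ultimately show ?case
    by (meson finite.emptyI finite.insertI finite_Un finite_SigmaI finite_imageI finite_subset)
qed

end

theory Submission
  imports Defs
begin

text \<open>
  Splitting a tree at its root gives a convolution recurrence for the sum over all trees. That the
  right-hand side satisfies it is Abel's identity: the polynomials \<open>A\<^sub>n(x) = x (x + n)\<^bsup>n-1\<^esup>\<close> are of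
  binomial type, because \<open>A\<^sub>n'(x) = n A\<^bsub>n-1\<^esub>(x + 1)\<close> and \<open>A\<^sub>n(0) = 0\<close> for \<open>n > 0\<close>.
  The convolution at \<open>x = y = z\<close> produces the factor \<open>(2z + n - 1)\<^bsup>n-2\<^esup>\<close>.
\<close>

text \<open>Without the case split, truncated subtraction would give \<open>x\<close> at
  \<open>n = 0\<close>, whereas the Abel polynomial of degree 0 is 1. The type covers polynomials as
  well as field elements.\<close>

definition abel :: "nat \<Rightarrow> 'a::comm_ring_1 \<Rightarrow> 'a" where
  "abel n x = (if n = 0 then 1 else x * (x + of_nat n) ^ (n - 1))"

lemma abel_0 [simp]: "abel 0 x = 1"
  by (simp add: abel_def)

lemma abel_at_0: "abel n 0 = (if n = 0 then 1 else 0)"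
  by (simp add: abel_def)

lemma poly_abel: "poly (abel n p) x = abel n (poly p x)"
  by (simp add: abel_def)

text \<open>With \<open>p = X + a\<close> and \<open>q = p + n + 1\<close>, the derivative of
  \<open>p * q ^ n\<close> for \<open>n > 0\<close> is \<open>q ^ (n - 1) * (q + n * p)\<close>, and
  \<open>q + n * p = (n + 1) * (p + 1)\<close>.\<close>

lemma pderiv_abel:
  fixes a :: "'a::idom"
  shows "pderiv (abel (Suc n) [:a, 1:]) = of_nat (Suc n) * abel n [:a + 1, 1:]"
proof (cases n)
  case 0
  then show ?thesis
    by (simp add: abel_def pderiv_pCons)
next
  case (Suc m)
  let ?p = "[:a, 1:]"
  let ?q = "?p + of_nat (Suc n)"
  have p1: "[:a + 1, 1:] = ?p + 1"
    by (simp add: one_pCons)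
  have pd_p: "pderiv ?p = 1"
    by (simp add: pderiv_pCons)
  have pd_q: "pderiv ?q = 1"
    by (simp only: pderiv_add pd_p pderiv_of_nat add_0_right)
  have "pderiv (abel (Suc n) ?p) = pderiv (?p * ?q ^ Suc m)"
    by (simp only: abel_def Suc) simp
  also have "\<dots> = ?q ^ Suc m + ?p * (of_nat n * ?q ^ m)"
    unfolding Suc[symmetric] pderiv_mult pd_p
    by (simp add: Suc pderiv_power_Suc pd_q[unfolded Suc] of_nat_mult_conv_smult
        del: power_Suc of_nat_Suc)
  also have "\<dots> = of_nat (Suc n) * ((?p + 1) * ?q ^ m)"
    by (simp only: power_Suc of_nat_Suc algebra_simps mult_1_left)
  also have "(?p + 1) * ?q ^ m = abel n (?p + 1)"
    unfolding abel_def Suc by (simp only: of_nat_Suc add_ac) simp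
  finally show ?thesis
    unfolding p1 .
qed

text \<open>Since \<open>b\<close> is constant, differentiation acts on one factor of each term. It
  replaces \<open>a\<close> by \<open>a + 1\<close>, hence the induction with \<open>a\<close>
  arbitrary. Both sides then have the same derivative, and evaluation at one point fixes the
  constant.\<close>

theorem abel_binomial_poly:
  fixes a b :: "'a::{idom, ring_char_0}"
  shows "(\<Sum>k\<le>m. of_nat (m choose k) * abel k [:a, 1:] * [:abel (m - k) b:])
         = abel m [:a + b, 1:]"
proof (induction m arbitrary: a)
  case 0
  then show ?case by simp
next
  case (Suc m)
  let ?L = "\<Sum>k\<le>Suc m. of_nat (Suc m choose k) * abel k [:a, 1:] * [:abel (Suc m - k) b:]"
  let ?R = "abel (Suc m) [:a + b, 1:]"
  have pd_sum: "pderiv (sum f A) = (\<Sum>k\<in>A. pderiv (f k))" for f :: "nat \<Rightarrow> 'a poly" and A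
    using higher_pderiv_sum[of 1 f A] by simp
  have pd_term: "pderiv (of_nat c * p * [:d:]) = of_nat c * pderiv p * [:d:]"
    for c d and p :: "'a poly"
    by (simp add: pderiv_mult pderiv_pCons algebra_simps pderiv_smult)
  have "pderiv ?L = (\<Sum>k\<le>Suc m. of_nat (Suc m choose k) * pderiv (abel k [:a, 1:])
      * [:abel (Suc m - k) b:])"
    by (simp only: pd_sum pd_term)
  \<comment> \<open>The term \<open>k = 0\<close> drops out because \<open>abel 0\<close> is the
    constant 1.\<close>
  also have "\<dots> = (\<Sum>k\<le>m. of_nat (Suc m choose Suc k) * pderiv (abel (Suc k) [:a, 1:])
      * [:abel (m - k) b:])"
    by (subst sum.atMost_Suc_shift) simp
  also have "\<dots> = (\<Sum>k\<le>m. of_nat (Suc m) *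
      (of_nat (m choose k) * abel k [:a + 1, 1:] * [:abel (m - k) b:]))"
  proof (rule sum.cong)
    fix k
    \<comment> \<open>The absorption identity turns the factor \<open>Suc k\<close> from the
      derivative into the common factor \<open>Suc m\<close>.\<close>
    have "of_nat (Suc m choose Suc k) * of_nat (Suc k) = (of_nat (Suc m) * of_nat (m choose k) :: 'a poly)"
      using Suc_times_binomial_eq[of m k] by (metis of_nat_mult)
    then show "of_nat (Suc m choose Suc k) * pderiv (abel (Suc k) [:a, 1:]) * [:abel (m - k) b:]
      = of_nat (Suc m) * (of_nat (m choose k) * abel k [:a + 1, 1:] * [:abel (m - k) b:])"
      unfolding pderiv_abel by (simp only: mult.assoc[symmetric])
  qed simp
  also have "\<dots> = of_nat (Suc m) * abel m [:a + 1 + b, 1:]"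
    by (simp only: sum_distrib_left[symmetric] Suc.IH)
  also have "\<dots> = pderiv ?R"
    by (simp only: pderiv_abel add.assoc add.commute[of 1])
  finally have "pderiv (?L - ?R) = 0"
    by (simp only: pderiv_diff diff_self)
  then obtain c where c: "?L - ?R = [:c:]"
    unfolding pderiv_eq_0_iff by (elim degree_eq_zeroE)
  \<comment> \<open>At \<open>- a\<close> the first Abel factor becomes \<open>abel k 0\<close>, so
    only \<open>k = 0\<close> survives; \<open>?R\<close> also takes the value
    \<open>abel (Suc m) b\<close> there.\<close>
  have "poly ?L (- a) = (\<Sum>k\<le>Suc m. if k = 0 then abel (Suc m) b else 0)"
    unfolding poly_sum by (intro sum.cong) (auto simp: poly_abel abel_at_0)
  then have "poly (?L - ?R) (- a) = 0"
    by (simp add: poly_abel)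
  then have "?L - ?R = 0"
    unfolding c by simp
  then show ?case by simp
qed

theorem abel_binomial:
  fixes a b :: "'a::{idom, ring_char_0}"
  shows "(\<Sum>k\<le>m. of_nat (m choose k) * abel k a * abel (m - k) b) = abel m (a + b)"
  using arg_cong[OF abel_binomial_poly[of m a b], of "\<lambda>p. poly p 0"]
  by (simp add: poly_sum poly_abel mult_ac)

lemma hook_length_root: "hook_length T [] = size T"
  by (simp add: hook_length_def card_vertices)

text \<open>Every path extending \<open>b # v\<close> starts with \<open>b\<close>, so all
  descendants lie in the subtree of that child, and prepending \<open>b\<close> is
  injective.\<close>

lemma hook_length_child:
  "hook_length \<langle>l, x, r\<rangle> (b # v) = hook_length (if b then r else l) v"
proof -
  have "{w \<in> vertices \<langle>l, x, r\<rangle>. prefix (b # v) w}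
      = (#) b ` {w \<in> vertices (if b then r else l). prefix v w}"
    by auto
  then show ?thesis
    by (simp add: hook_length_def card_image)
qed

lemma prod_hook_length_Node:
  fixes f :: "nat \<Rightarrow> 'a::comm_monoid_mult"
  shows "(\<Prod>v\<in>vertices \<langle>l, x, r\<rangle>. f (hook_length \<langle>l, x, r\<rangle> v))
    = f (Suc (size l + size r)) * ((\<Prod>v\<in>vertices l. f (hook_length l v))
        * (\<Prod>v\<in>vertices r. f (hook_length r v)))"
proof -
  have "vertices \<langle>l, x, r\<rangle> = insert [] ((#) False ` vertices l \<union> (#) True ` vertices r)"
    by simp
  moreover have "(\<Prod>v\<in>(#) False ` vertices l \<union> (#) True ` vertices r. f (hook_length \<langle>l, x, r\<rangle> v))
      = (\<Prod>v\<in>(#) False ` vertices l. f (hook_length \<langle>l, x, r\<rangle> v))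
        * (\<Prod>v\<in>(#) True ` vertices r. f (hook_length \<langle>l, x, r\<rangle> v))"
    by (rule prod.union_disjoint) auto
  ultimately show ?thesis
    by (simp add: prod.reindex hook_length_root hook_length_child image_iff del: vertices.simps)
qed

lemma binary_trees_0: "binary_trees 0 = {\<langle>\<rangle>}"
  by (auto simp: binary_trees_def)

text \<open>A tree of positive size is a node with label \<open>()\<close>, so its left and right
  subtrees determine it; the sum is grouped by the size \<open>k\<close> of the left one.\<close>

lemma sum_binary_trees_Suc:
  "(\<Sum>T\<in>binary_trees (Suc m). g T)
    = (\<Sum>k\<le>m. \<Sum>l\<in>binary_trees k. \<Sum>r\<in>binary_trees (m - k). g \<langle>l, (), r\<rangle>)"
proof -
  let ?I = "SIGMA k:{..m}. binary_trees k \<times> binary_trees (m - k)"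
  have "(\<Sum>T\<in>binary_trees (Suc m). g T) = (\<Sum>(k, l, r)\<in>?I. g \<langle>l, (), r\<rangle>)"
  proof (rule sum.reindex_bij_witness[where
        i = "\<lambda>(k, l, r). \<langle>l, (), r\<rangle>" and j = "\<lambda>T. (size (left T), left T, right T)"])
    fix T assume "T \<in> binary_trees (Suc m)"
    then show "(case (size (left T), left T, right T) of (k, l, r) \<Rightarrow> \<langle>l, (), r\<rangle>) = T"
      and "(size (left T), left T, right T) \<in> ?I"
      and "(case (size (left T), left T, right T) of (k, l, r) \<Rightarrow> g \<langle>l, (), r\<rangle>) = g T"
      by (cases T; auto simp: binary_trees_def)+
  qed (auto simp: binary_trees_def)
  also have "\<dots> = (\<Sum>k\<le>m. \<Sum>l\<in>binary_trees k. \<Sum>r\<in>binary_trees (m - k). g \<langle>l, (), r\<rangle>)"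
    by (simp add: sum.Sigma sum.cartesian_product split_def)
  finally show ?thesis .
qed

text \<open>The root has hook length \<open>Suc m\<close> in every tree of that size, so its weight
  factors out; what remains is a product of independent sums over the two subtrees.\<close>

lemma sum_prod_hook_length_Suc:
  fixes f :: "nat \<Rightarrow> 'a::comm_semiring_1"
  defines "S \<equiv> \<lambda>n. \<Sum>T\<in>binary_trees n. \<Prod>v\<in>vertices T. f (hook_length T v)"
  shows "S (Suc m) = f (Suc m) * (\<Sum>k\<le>m. S k * S (m - k))"
proof -
  have "S (Suc m) = (\<Sum>k\<le>m. \<Sum>l\<in>binary_trees k. \<Sum>r\<in>binary_trees (m - k).
      f (Suc m) * ((\<Prod>v\<in>vertices l. f (hook_length l v)) * (\<Prod>v\<in>vertices r. f (hook_length r v))))"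
    unfolding S_def sum_binary_trees_Suc prod_hook_length_Node
    by (intro sum.cong) (auto simp: binary_trees_def)
  then show ?thesis
    unfolding S_def sum_product by (simp only: sum_distrib_left)
qed

text \<open>For nonzero \<open>x\<close>, the integer exponent absorbs the special case
  \<open>n = 0\<close>, as \<open>x * x powi (- 1) = 1\<close>.\<close>

lemma abel_eq_powi:
  fixes x :: "'a::field"
  assumes "x \<noteq> 0"
  shows "abel n x = x * (x + of_nat n) powi (int n - 1)"
proof (cases n)
  case (Suc k)
  then have "int n - 1 = int k" by simp
  then show ?thesis
    unfolding abel_def Suc by simp
qed (use assms in \<open>simp add: power_int_minus\<close>)

text \<open>The hypothesis keeps every base \<open>2 * z + h - 1\<close> nonzero for
  \<open>h \<ge> 1\<close>. The case \<open>n = 0\<close> is included because the induction reaches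
  empty subtrees.\<close>

theorem sum_prod_hook_length:
  fixes z :: "'a::field_char_0"
  assumes z: "\<And>m::nat. 2 * z + of_nat m \<noteq> 0"
  shows "(\<Sum>T\<in>binary_trees n. \<Prod>v\<in>vertices T.
            (z + of_nat (hook_length T v)) powi (int (hook_length T v) - 1)
            / (of_nat (hook_length T v)
               * (2 * z + of_nat (hook_length T v) - 1) powi (int (hook_length T v) - 2)))
         = 2 ^ n / fact n * abel n z"
proof (induction n rule: less_induct)
  case (less n)
  let ?f = "\<lambda>h. (z + of_nat h) powi (int h - 1)
      / (of_nat h * (2 * z + of_nat h - 1) powi (int h - 2))"
  define S where "S n = (\<Sum>T\<in>binary_trees n. \<Prod>v\<in>vertices T. ?f (hook_length T v))" for n
  have IH: "S k = 2 ^ k / fact k * abel k z" if "k < n" for k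
    using less.IH[OF that] unfolding S_def .
  have "S n = 2 ^ n / fact n * abel n z"
  proof (cases n)
    case 0
    then show ?thesis
      by (simp add: S_def binary_trees_0)
  next
    case (Suc m)
    have z2: "2 * z \<noteq> 0"
      using z[of 0] by simp
    \<comment> \<open>The factorials of the two induction hypotheses combine into a binomial
      coefficient, which makes the convolution an Abel sum.\<close>
    have "S k * S (m - k) = 2 ^ m / fact m * (of_nat (m choose k) * abel k z * abel (m - k) z)"
      if "k \<le> m" for k
    proof -
      have "(2::'a) ^ k * 2 ^ (m - k) = 2 ^ m"
        using that by (simp flip: power_add)
      then have "S k * S (m - k) = 2 ^ m / (fact k * fact (m - k)) * abel k z * abel (m - k) z"
        using that by (simp add: IH Suc)
      then show ?thesis
        using that by (simp add: binomial_fact)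
    qed
    then have "(\<Sum>k\<le>m. S k * S (m - k))
        = (\<Sum>k\<le>m. 2 ^ m / fact m * (of_nat (m choose k) * abel k z * abel (m - k) z))"
      by (intro sum.cong) simp_all
    then have "(\<Sum>k\<le>m. S k * S (m - k)) = 2 ^ m / fact m * abel m (z + z)"
      by (simp only: abel_binomial sum_distrib_left[symmetric])
    \<comment> \<open>In this form the power is exactly the one in the denominator of the weight at
      hook length \<open>Suc m\<close>, also for \<open>m = 0\<close>.\<close>
    also have "abel m (z + z) = 2 * z * (2 * z + of_nat m) powi (int m - 1)"
      unfolding mult_2[symmetric] by (rule abel_eq_powi[OF z2])
    finally have "S n = ?f (Suc m) * (2 ^ m / fact m * (2 * z * (2 * z + of_nat m) powi (int m - 1)))"
      using sum_prod_hook_length_Suc[of ?f m] unfolding S_def Suc by simp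
    also have "?f (Suc m) = (z + of_nat n) ^ m / (of_nat n * (2 * z + of_nat m) powi (int m - 1))"
      by (simp add: Suc algebra_simps)
    \<comment> \<open>The powers of \<open>2 * z + m\<close> cancel; the spare 2 completes
      \<open>2 ^ n\<close>, the factor \<open>n\<close> completes \<open>fact n\<close>, and
      \<open>z * (z + n) ^ m\<close> is \<open>abel n z\<close>.\<close>
    also have "\<dots> * (2 ^ m / fact m * (2 * z * (2 * z + of_nat m) powi (int m - 1)))
        = 2 ^ n / fact n * abel n z"
      using z[of m] by (simp add: Suc abel_def power_int_eq_0_iff field_simps del: of_nat_Suc)
    finally show ?thesis .
  qed
  then show ?case
    unfolding S_def .
qed

text \<open>The element is the image of the polynomial \<open>2 * X + m\<close>, whose leading
  coefficient is nonzero, under an injective embedding.\<close>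

lemma two_indet_add_of_nat_neq_0: "2 * indet + of_nat m \<noteq> 0"
proof -
  have "to_fract (of_nat m :: rat poly) = of_nat m"
    by (induction m) simp_all
  then have "2 * indet + of_nat m = to_fract ([:0, 1:] + [:0, 1:] + of_nat m)"
    unfolding indet_def mult_2 by (simp only: to_fract_add)
  also have "[:0, 1:] + [:0, 1:] + of_nat m = [:of_nat m, 2 :: rat:]"
    by (simp add: of_nat_poly)
  finally show ?thesis
    by simp
qed

theorem theorem1:
  fixes n :: nat
  assumes "n \<ge> 1"
  shows "(\<Sum>T\<in>binary_trees n. \<Prod>v\<in>vertices T.
            (indet + of_nat (hook_length T v)) powi (int (hook_length T v) - 1)
            / (of_nat (hook_length T v)
               * (2 * indet + of_nat (hook_length T v) - 1) powi (int (hook_length T v) - 2)))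
         = 2 ^ n * indet / fact n * (of_nat n + indet) ^ (n - 1)"
  unfolding sum_prod_hook_length[OF two_indet_add_of_nat_neq_0]
  using assms by (simp add: abel_def add.commute)

end
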